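(* Let $D$ be a set, $k$ a positive integer, $X\subseteq D^k$ a finite symmetric subset, $j$ a positive integer, and $f:X\to\mathbb{C}$ a symmetric function, i.e. $f(x_{\tau(1)},\dots,x_{\tau(k)})=f(x_1,\dots,x_k)$ for all $(x_1,\dots,x_k)\in X$ and $\tau\in S_k$. Then $$\sum_{[x_1,\dots,x_k]\in\mathcal{M}_j(X)} f(x_1,\dots,x_k)=\frac{1}{k!}\sum_{\tau\in S_k} w_j(\tau)\sum_{(x_1,\dots,x_k)\in X_\tau} f(x_1,\dots,x_k).$$ In particular, for $j\ge k$, $$\sum_{[x_1,\dots,x_k]\in\mathcal{M}(X)} f(x_1,\dots,x_k)=\frac{1}{k!}\sum_{\tau\in S_k}\sum_{(x_1,\dots,x_k)\in X_\tau} f(x_1,\dots,x_k).$$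
   Context: A subset $X\subseteq D^k$ is symmetric if $(x_{\tau(1)},\dots,x_{\tau(k)})\in X$ whenever $(x_1,\dots,x_k)\in X$ and $\tau\in S_k$. $\mathcal{M}(X)=\{[x_1,\dots,x_k]:(x_1,\dots,x_k)\in X\}$ is the set of $k$-multisets with underlying ordered tuples in $X$; $\mathcal{M}_j(X)$ is the subset of those in which every element has multiplicity at most $j$. Since $f$ is symmetric, $f$ evaluated on any ordering of a multiset is well defined. For $\tau\in S_k$, $X_\tau$ is the set of $(x_1,\dots,x_k)\in X$ with $x_i$ constant on each cycle of $\tau$. If $\tau$ has cycle lengths $\ell_1,\dots,\ell_{c(\tau)}$ (fixed points counted as cycles of length 1), $w_j(\tau)=\prod_{i=1}^{c(\tau)}\bigl(1-(j+1)\,1_{(j+1)\mid \ell_i}\bigr)$, with $1_S$ the indicator of the statement $S$. *)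

theory Defs
  imports Complex_Main "HOL-Library.NList" "HOL-Combinatorics.Permutations" "HOL-Combinatorics.Orbits"
begin

text \<open>
  A tuple in \<open>D\<^sup>k\<close> is a list in \<^term>\<open>nlists k D\<close>, with positions \<open>0, \<dots>, k - 1\<close>, and \<open>S\<^sub>k\<close> is the
  set of all \<open>\<tau>\<close> with \<^prop>\<open>\<tau> permutes {..<k}\<close>.  The list \<^term>\<open>permute_list \<tau> xs\<close> has entry
  \<open>xs ! \<tau> i\<close> at position \<open>i\<close>.
\<close>

definition symmetric_set :: "nat \<Rightarrow> 'a list set \<Rightarrow> bool" where
  "symmetric_set k X \<longleftrightarrow>
     (\<forall>xs\<in>X. \<forall>\<tau>. \<tau> permutes {..<k} \<longrightarrow> permute_list \<tau> xs \<in> X)"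

definition symmetric_fun :: "nat \<Rightarrow> 'a list set \<Rightarrow> ('a list \<Rightarrow> 'b) \<Rightarrow> bool" where
  "symmetric_fun k X f \<longleftrightarrow>
     (\<forall>xs\<in>X. \<forall>\<tau>. \<tau> permutes {..<k} \<longrightarrow> f (permute_list \<tau> xs) = f xs)"

definition multisets :: "'a list set \<Rightarrow> 'a multiset set" where
  "multisets X = mset ` X"

definition multisets_le :: "nat \<Rightarrow> 'a list set \<Rightarrow> 'a multiset set" where
  "multisets_le j X = {M \<in> multisets X. \<forall>x. count M x \<le> j}"

text \<open>
  The value of \<open>f\<close> on an ordering of \<open>M\<close> in \<open>X\<close>.  For symmetric \<open>f\<close> the choice of the ordering
  is irrelevant, see \<open>on_mset_eq\<close> below.
\<close>

definition on_mset :: "'a list set \<Rightarrow> ('a list \<Rightarrow> 'b) \<Rightarrow> 'a multiset \<Rightarrow> 'b" where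
  "on_mset X f M = f (SOME xs. xs \<in> X \<and> mset xs = M)"

lemma on_mset_eq:
  assumes "X \<subseteq> nlists k D" and "symmetric_fun k X f" and "xs \<in> X"
  shows "on_mset X f (mset xs) = f xs"
proof -
  define ys where "ys = (SOME ys. ys \<in> X \<and> mset ys = mset xs)"
  have ys: "ys \<in> X \<and> mset ys = mset xs"
    unfolding ys_def by (rule someI[of _ xs]) (use assms(3) in simp)
  obtain \<tau> where \<tau>: "\<tau> permutes {..<length xs}" "permute_list \<tau> xs = ys"
    using ys mset_eq_permutation[of ys xs] by blast
  have "length xs = k"
    using assms(1,3) unfolding nlists_def by blast
  with \<tau>(1) have "f (permute_list \<tau> xs) = f xs"
    using assms(2,3) unfolding symmetric_fun_def by blast
  then have "f ys = f xs"
    unfolding \<tau>(2) .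
  then show ?thesis
    unfolding on_mset_def ys_def .
qed

text \<open>
  The cycles of a permutation of \<open>{..<k}\<close>, as subsets of \<open>{..<k}\<close>; a fixed point \<open>i\<close> contributes
  the cycle \<open>{i}\<close>.
\<close>

definition cycle_sets :: "nat \<Rightarrow> (nat \<Rightarrow> nat) \<Rightarrow> nat set set" where
  "cycle_sets k \<tau> = orbit \<tau> ` {..<k}"

definition constant_on_cycles :: "nat \<Rightarrow> 'a list set \<Rightarrow> (nat \<Rightarrow> nat) \<Rightarrow> 'a list set" where
  "constant_on_cycles k X \<tau> =
     {xs \<in> X. \<forall>C\<in>cycle_sets k \<tau>. \<forall>i\<in>C. \<forall>i'\<in>C. xs ! i = xs ! i'}"

definition weight :: "nat \<Rightarrow> nat \<Rightarrow> (nat \<Rightarrow> nat) \<Rightarrow> int" where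
  "weight k j \<tau> =
     (\<Prod>C\<in>cycle_sets k \<tau>. 1 - (int j + 1) * of_bool ((j + 1) dvd card C))"

end

theory Submission
  imports Defs "HOL-Combinatorics.Multiset_Permutations"
begin

text \<open>
  Exchanging the two sums on the right leaves, for each tuple \<open>x\<close>, the total weight of the
  permutations preserving the colouring \<open>i \<mapsto> x\<^sub>i\<close> of the positions.  This total is \<open>\<Prod> m\<^sub>y!\<close>,
  with \<open>m\<^sub>y\<close> the multiplicity of \<open>y\<close> in \<open>x\<close>, if all \<open>m\<^sub>y \<le> j\<close>, and \<open>0\<close> otherwise; as a multiset has
  \<open>k! / \<Prod> m\<^sub>y!\<close> orderings, the formula follows.

  To evaluate the total, pick a position \<open>a\<close> and allow the cycle through \<open>a\<close> to be weighted as if it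
  were longer by some \<open>t\<close>.  Contracting \<open>a\<close> out of its cycle either removes the fixed point \<open>a\<close>
  or leaves a permutation of the remaining positions in which the successor of \<open>a\<close> is
  the new marked position, with \<open>t + 1\<close> in place of \<open>t\<close>.  Solving this recursion reduces the claim to the
  fact that each window of \<open>j + 1\<close> consecutive integers contains exactly one multiple of \<open>j + 1\<close>.
\<close>

section \<open>Weighted counts of colour-preserving permutations\<close>

definition colour_perms :: "('b \<Rightarrow> 'a) \<Rightarrow> 'b set \<Rightarrow> ('b \<Rightarrow> 'b) set" where
  "colour_perms x S = {\<tau>. \<tau> permutes S \<and> (\<forall>i. x (\<tau> i) = x i)}"

definition cycle_weight :: "(nat \<Rightarrow> 'r::comm_ring_1) \<Rightarrow> 'b set \<Rightarrow> ('b \<Rightarrow> 'b) \<Rightarrow> 'r" where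
  "cycle_weight c S \<tau> = (\<Prod>C\<in>orbit \<tau> ` S. c (card C))"

text \<open>\<open>t\<close> records how many points have already been contracted out of the cycle
  through \<open>a\<close>, so the cycle is still charged for its original length.\<close>

definition marked_weight ::
  "(nat \<Rightarrow> 'r::comm_ring_1) \<Rightarrow> nat \<Rightarrow> 'b \<Rightarrow> 'b set \<Rightarrow> ('b \<Rightarrow> 'b) \<Rightarrow> 'r" where
  "marked_weight c t a S \<tau> =
     c (card (orbit \<tau> a) + t) * (\<Prod>C\<in>orbit \<tau> ` S - {orbit \<tau> a}. c (card C))"

definition total_weight :: "(nat \<Rightarrow> 'r::comm_ring_1) \<Rightarrow> ('b \<Rightarrow> 'a) \<Rightarrow> 'b set \<Rightarrow> 'r" where
  "total_weight c x S = (\<Sum>\<tau>\<in>colour_perms x S. cycle_weight c S \<tau>)"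

definition marked_total ::
  "(nat \<Rightarrow> 'r::comm_ring_1) \<Rightarrow> nat \<Rightarrow> 'b \<Rightarrow> ('b \<Rightarrow> 'a) \<Rightarrow> 'b set \<Rightarrow> 'r" where
  "marked_total c t a x S = (\<Sum>\<tau>\<in>colour_perms x S. marked_weight c t a S \<tau>)"

lemma total_weight_eq_marked_total:
  assumes "finite S" "a \<in> S"
  shows "total_weight c x S = marked_total c 0 a x S"
proof -
  have "cycle_weight c S \<tau> = marked_weight c 0 a S \<tau>" for \<tau>
    using assms prod.remove[of "orbit \<tau> ` S" "orbit \<tau> a" "\<lambda>C. c (card C)"]
    by (simp add: marked_weight_def cycle_weight_def)
  then show ?thesis by (simp add: total_weight_def marked_total_def)
qed

section \<open>Orbits when one point is inserted into a cycle\<close>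

lemma self_in_orbit_permutes:
  assumes "finite S" "p permutes S"
  shows "i \<in> orbit p i"
  using assms permutation_permutes by (blast intro: permutation_self_in_orbit)

lemma orbit_eq_permutes:
  assumes "finite S" "p permutes S" "i \<in> orbit p i'"
  shows "orbit p i = orbit p i'"
  by (rule orbit_cyclic_eq3[OF cyclic_on_orbit[OF assms(2,1)] assms(3)])

text \<open>\<open>q\<close> is \<open>p\<close> with the new point \<open>a\<close> spliced into
  the cycle of \<open>b\<close>, directly before \<open>b\<close>: the \<open>p\<close>-predecessor
  of \<open>b\<close> now goes to \<open>a\<close>, and \<open>a\<close> goes to \<open>b\<close>.
  Every other point of \<open>S\<close> moves as before.\<close>

lemma orbit_transpose_comp:
  assumes S: "finite S" "p permutes S" and ab: "a \<notin> S" "b \<in> S"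
  defines "q \<equiv> transpose a b \<circ> p"
  shows "orbit q b = insert a (orbit p b)"
    and "orbit q a = insert a (orbit p b)"
    and "i \<in> S \<Longrightarrow> i \<notin> orbit p b \<Longrightarrow> orbit q i = orbit p i"
proof -
  have pa: "p a = a" using S(2) ab(1) by (rule permutes_not_in)
  have qp: "q permutes insert a S"
    unfolding q_def using permutes_insert[of a S] S(2) ab(2) by auto
  have pa_iff: "p y = a \<longleftrightarrow> y = a" for y
    using pa permutes_inj[OF S(2)] by (metis injD)
  have qa: "q a = b" by (simp add: q_def pa)
  have qb: "q y = a" if "p y = b" for y using that by (simp add: q_def)
  have q: "q y = p y" if "p y \<noteq> b" "y \<noteq> a" for y
    using that pa_iff by (simp add: q_def transpose_def)
  \<comment> \<open>A step of \<open>p\<close> is either a step of \<open>q\<close> or, when it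
    lands on \<open>b\<close>, the two steps of \<open>q\<close> that pass through
    \<open>a\<close>.\<close>
  have step: "p y \<in> orbit q b" if "q y \<in> orbit q b" "y \<noteq> a" for y
  proof (cases "p y = b")
    case True
    then show ?thesis using qb[OF True] qa that(1) by (metis orbit.step)
  next
    case False
    then show ?thesis using q[OF False that(2)] that(1) by simp
  qed
  have sub: "orbit p b \<subseteq> S" using S(2) ab(2) by (rule permutes_orbit_subset)
  have *: "y \<in> orbit q b" if "y \<in> orbit p b" for y
    using that
  proof induction
    case base
    show ?case using ab by (intro step orbit.base) auto
  next
    case (step y)
    then show ?case using sub ab by (intro \<open>\<And>y. _ \<Longrightarrow> _ \<Longrightarrow> p y \<in> orbit q b\<close> orbit.step) auto
  qed
  \<comment> \<open>The predecessor \<open>z\<close> of \<open>b\<close> is the place where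
    \<open>a\<close> enters the orbit, since \<open>q z = a\<close>.\<close>
  obtain z where z: "p z = b" "z \<in> orbit p b"
  proof -
    have b: "b \<in> orbit p b" using S by (rule self_in_orbit_permutes)
    then show thesis
    proof cases
      case base
      then show ?thesis using that[of b] b by simp
    next
      case (step y)
      then show ?thesis using that[of y] by simp
    qed
  qed
  have "a \<in> orbit q b" using *[OF z(2)] qb[OF z(1)] by (metis orbit.step)
  moreover have "y \<in> insert a (orbit p b)" if "y \<in> orbit q b" for y
    using that
  proof induction
    case base
    have "b \<noteq> a" using ab by auto
    then show ?case
      using q[of b] qb[of b] orbit.base[of p b] by (cases "p b = b") simp_all
  next
    case (step y)
    have "b \<in> orbit p b" using S by (rule self_in_orbit_permutes)
    with step.IH show ?case
      using qa q[of y] qb[of y] orbit.step[of y p b]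
      by (cases "y = a"; cases "p y = b") simp_all
  qed
  ultimately show 1: "orbit q b = insert a (orbit p b)" using * by blast
  show "orbit q a = insert a (orbit p b)"
    using orbit_eq_permutes[of "insert a S" q a b] qp S(1) 1 by auto
  assume i: "i \<in> S" "i \<notin> orbit p b"
  have ni: "b \<notin> orbit p i" using i orbit_eq_permutes[OF S, of b i] self_in_orbit_permutes[OF S, of i] by auto
  have isub: "orbit p i \<subseteq> S" using S(2) i(1) by (rule permutes_orbit_subset)
  have qy: "q y = p y" if "y \<in> orbit p i" for y
    using that ni isub ab by (intro q) (auto dest: orbit.step)
  have "i \<in> orbit p i" using S by (rule self_in_orbit_permutes)
  then show "orbit q i = orbit p i"
    using qy by (rule orbit_cong)
qed

section \<open>The recursion for the marked total\<close>

lemma marked_weight_insert_self: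
  assumes "finite S" "p permutes S" "a \<notin> S"
  shows "marked_weight c t a (insert a S) p = c (Suc t) * cycle_weight c S p"
proof -
  have pa: "p a = a" using assms(2,3) by (rule permutes_not_in)
  have a: "orbit p a = {a}"
    using pa by (simp add: orbit_eq_singleton_iff)
  moreover have "orbit p i \<noteq> {a}" if "i \<in> S" for i
    using permutes_orbit_subset[OF assms(2) that] assms(3) by auto
  then have "orbit p ` insert a S - {orbit p a} = orbit p ` S"
    using a by auto
  ultimately show ?thesis by (simp add: marked_weight_def cycle_weight_def)
qed

text \<open>Removing \<open>a\<close> shortens its cycle by one, which \<open>Suc t\<close> makes up
  for, and the mark passes to the successor \<open>b\<close>. The remaining cycles are the same sets
  on both sides.\<close>

lemma marked_weight_transpose_comp:
  assumes "finite S" "p permutes S" "a \<notin> S" "b \<in> S"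
  shows "marked_weight c t a (insert a S) (transpose a b \<circ> p) = marked_weight c (Suc t) b S p"
proof -
  let ?q = "transpose a b \<circ> p"
  note o = orbit_transpose_comp[OF assms]
  have sub: "orbit p b \<subseteq> S" using assms by (intro permutes_orbit_subset)
  then have fin: "finite (orbit p b)" "a \<notin> orbit p b"
    using assms finite_subset by blast+
  have eq: "orbit p i = orbit p b" "orbit ?q i = orbit ?q b" if "i \<in> orbit p b" for i
  proof -
    show "orbit p i = orbit p b" using assms that by (intro orbit_eq_permutes)
    have "?q permutes insert a S" using permutes_insert[of a S] assms by auto
    then show "orbit ?q i = orbit ?q b"
      using assms(1) that o(1) by (intro orbit_eq_permutes[of "insert a S"]) auto
  qed
  have ne: "orbit p i \<noteq> insert a (orbit p b)" if "i \<in> S" for i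
    using permutes_orbit_subset[OF assms(2) that] assms(3) by auto
  have mem: "orbit p i \<noteq> orbit p b" if "i \<notin> orbit p b" for i
    using that self_in_orbit_permutes[OF assms(1,2), of i] by auto
  have "orbit ?q ` insert a S - {orbit ?q a} = orbit p ` S - {orbit p b}" (is "?L = ?R")
  proof
    show "?L \<subseteq> ?R"
    proof
      fix C assume "C \<in> ?L"
      then obtain i where i: "i \<in> S" "C = orbit ?q i" "C \<noteq> orbit ?q b" using o(1,2) by auto
      then have "i \<notin> orbit p b" using eq(2) by auto
      then show "C \<in> ?R" using i o(3) mem by auto
    qed
    show "?R \<subseteq> ?L"
    proof
      fix C assume "C \<in> ?R"
      then obtain i where i: "i \<in> S" "C = orbit p i" "C \<noteq> orbit p b" by auto
      then have "i \<notin> orbit p b" using eq(1) by auto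
      then have "C = orbit ?q i" using i o(3) by auto
      then show "C \<in> ?L" using i ne[of i] o(2) by auto
    qed
  qed
  then show ?thesis using fin by (simp add: marked_weight_def o(2))
qed

text \<open>The composite sends \<open>a\<close> to \<open>b\<close>, which forces equal colours;
  once the colours agree, swapping \<open>a\<close> and \<open>b\<close> is invisible to
  \<open>x\<close>.\<close>

lemma colour_perms_transpose_comp:
  assumes "p permutes S" "a \<notin> S" "b \<in> S"
  shows "transpose a b \<circ> p \<in> colour_perms x (insert a S) \<longleftrightarrow> x b = x a \<and> p \<in> colour_perms x S"
proof -
  have pa: "p a = a" using assms(1,2) by (rule permutes_not_in)
  have q: "transpose a b \<circ> p permutes insert a S"
    using permutes_insert[of a S] assms by auto
  have "(\<forall>i. x (transpose a b (p i)) = x i) \<longleftrightarrow> x b = x a \<and> (\<forall>i. x (p i) = x i)"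
  proof
    assume l: "\<forall>i. x (transpose a b (p i)) = x i"
    then have ab: "x b = x a" using pa by (metis transpose_apply_first)
    moreover have "x (transpose a b y) = x y" for y using ab by (simp add: transpose_def)
    ultimately show "x b = x a \<and> (\<forall>i. x (p i) = x i)" using l by simp
  next
    assume "x b = x a \<and> (\<forall>i. x (p i) = x i)"
    then show "\<forall>i. x (transpose a b (p i)) = x i" by (simp add: transpose_def) metis
  qed
  then show ?thesis using q assms(1) by (simp add: colour_perms_def)
qed

text \<open>Each permutation of \<open>insert a S\<close> is \<open>transpose a b \<circ> p\<close>
  for a unique \<open>b\<close> in \<open>insert a S\<close> and a unique \<open>p\<close> permuting
  \<open>S\<close>. The choice \<open>b = a\<close> makes \<open>a\<close> a fixed point and gives
  the first term; the choices \<open>b \<in> S\<close> give the sum.\<close>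

lemma marked_total_insert:
  assumes S: "finite S" "a \<notin> S"
  shows "marked_total c t a x (insert a S) =
    c (Suc t) * total_weight c x S + (\<Sum>b | b \<in> S \<and> x b = x a. marked_total c (Suc t) b x S)"
proof -
  let ?P = "{p. p permutes S}"
  \<comment> \<open>Extension by zero to all permutations, the index set to which the decomposition
    applies.\<close>
  let ?h = "\<lambda>q. if q \<in> colour_perms x (insert a S) then marked_weight c t a (insert a S) q else 0"
  have fP: "finite ?P" using S(1) by (rule finite_permutations)
  have "marked_total c t a x (insert a S) = (\<Sum>q | q permutes insert a S. ?h q)"
    unfolding marked_total_def using S
    by (intro sum.mono_neutral_cong_left) (auto simp: finite_permutations colour_perms_def)
  also have "\<dots> = (\<Sum>b\<in>insert a S. \<Sum>p\<in>?P. ?h (transpose a b \<circ> p))"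
    by (rule sum_over_permutations_insert[OF S])
  also have "\<dots> = (\<Sum>p\<in>?P. ?h p) + (\<Sum>b\<in>S. \<Sum>p\<in>?P. ?h (transpose a b \<circ> p))"
    by (simp only: sum.insert[OF S] transpose_same id_comp)
  also have "(\<Sum>p\<in>?P. ?h p) = c (Suc t) * total_weight c x S"
  proof -
    have "p \<in> colour_perms x (insert a S) \<longleftrightarrow> p \<in> colour_perms x S" if "p \<in> ?P" for p
      using that permutes_subset[of p S "insert a S"] by (auto simp: colour_perms_def)
    then have "(\<Sum>p\<in>?P. ?h p) =
        (\<Sum>p\<in>?P. if p \<in> colour_perms x S then c (Suc t) * cycle_weight c S p else 0)"
      using S by (intro sum.cong refl) (auto simp: marked_weight_insert_self)
    also have "\<dots> = (\<Sum>p\<in>colour_perms x S. c (Suc t) * cycle_weight c S p)"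
      using fP by (intro sum.mono_neutral_cong_right) (auto simp: colour_perms_def)
    finally show ?thesis by (simp add: total_weight_def sum_distrib_left)
  qed
  also have "(\<Sum>b\<in>S. \<Sum>p\<in>?P. ?h (transpose a b \<circ> p)) =
      (\<Sum>b\<in>S. if x b = x a then marked_total c (Suc t) b x S else 0)"
  proof (intro sum.cong refl)
    fix b assume b: "b \<in> S"
    have "(\<Sum>p\<in>?P. ?h (transpose a b \<circ> p)) =
        (\<Sum>p\<in>?P. if x b = x a \<and> p \<in> colour_perms x S then marked_weight c (Suc t) b S p else 0)"
      using S b
      by (intro sum.cong refl) (simp add: colour_perms_transpose_comp marked_weight_transpose_comp)
    also have "\<dots> = (if x b = x a then marked_total c (Suc t) b x S else 0)"
    proof (cases "x b = x a")
      case True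
      have "(\<Sum>p\<in>?P. if p \<in> colour_perms x S then marked_weight c (Suc t) b S p else 0) =
          marked_total c (Suc t) b x S"
        unfolding marked_total_def
        using fP by (intro sum.mono_neutral_cong_right) (auto simp: colour_perms_def)
      then show ?thesis using True by simp
    qed simp
    finally show "(\<Sum>p\<in>?P. ?h (transpose a b \<circ> p)) =
      (if x b = x a then marked_total c (Suc t) b x S else 0)" .
  qed
  also have "\<dots> = (\<Sum>b | b \<in> S \<and> x b = x a. marked_total c (Suc t) b x S)"
    using S(1) by (simp add: sum.inter_filter)
  finally show ?thesis .
qed

section \<open>Arithmetic of the cycle factors\<close>

definition cyc :: "nat \<Rightarrow> nat \<Rightarrow> int" where
  "cyc j l = 1 - (int j + 1) * of_bool ((j + 1) dvd l)"

definition bounded_fact :: "nat \<Rightarrow> nat \<Rightarrow> int" where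
  "bounded_fact j m = (if m \<le> j then fact m else 0)"

text \<open>The solution of the recursion on a class of \<open>m\<close> positions, divided by
  \<open>fact (m - 1)\<close>. The index \<open>i\<close> is the number of positions outside the
  marked cycle: there are \<open>fact (m - 1) / fact i\<close> such cycles, and the other positions
  contribute \<open>bounded_fact j i\<close>.\<close>

definition cyc_sum :: "nat \<Rightarrow> nat \<Rightarrow> nat \<Rightarrow> int" where
  "cyc_sum j m t = (\<Sum>i<m. cyc j (m - i + t) * of_bool (i \<le> j))"

text \<open>The summand \<open>i = m\<close> splits off; for \<open>i < m\<close> the lengths
  \<open>Suc m - i + t\<close> and \<open>m - i + Suc t\<close> coincide.\<close>

lemma cyc_sum_Suc: "cyc_sum j (Suc m) t = cyc j (Suc t) * of_bool (m \<le> j) + cyc_sum j m (Suc t)"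
proof -
  have "(\<Sum>i<m. cyc j (Suc m - i + t) * of_bool (i \<le> j)) = cyc_sum j m (Suc t)"
    unfolding cyc_sum_def by (intro sum.cong refl) (simp add: Suc_diff_le)
  then show ?thesis by (simp add: cyc_sum_def)
qed

text \<open>By periodicity, shifting the window drops and adds equal values. In the window starting
  at \<open>0\<close> the only multiple of \<open>j + 1\<close> is \<open>0\<close> itself, whose
  value \<open>- j\<close> cancels the \<open>j\<close> ones.\<close>

lemma sum_cyc_window: "(\<Sum>l\<in>{n..<n + (j + 1)}. cyc j l) = 0"
proof (induction n)
  case 0
  have "cyc j l = (if l = 0 then - int j else 1)" if "l \<in> {0..<0 + (j + 1)}" for l
    using that by (auto simp: cyc_def dvd_imp_le dest: nat_dvd_not_less[rotated])
  then have "(\<Sum>l\<in>{0..<0 + (j + 1)}. cyc j l) = (\<Sum>l<j + 1. if l = 0 then - int j else 1)"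
    by (intro sum.cong) auto
  also have "\<dots> = 0" by (simp add: sum.lessThan_Suc_shift del: sum.lessThan_Suc)
  finally show ?case .
next
  case (Suc n)
  have "cyc j (n + (j + 1)) = cyc j n" unfolding cyc_def dvd_add_triv_right_iff ..
  moreover have "(\<Sum>l\<in>{n..<n + (j + 1)}. cyc j l) =
    cyc j n + (\<Sum>l\<in>{Suc n..<n + (j + 1)}. cyc j l)"
    by (rule sum.atLeast_Suc_lessThan) simp
  moreover have "(\<Sum>l\<in>{Suc n..<Suc n + (j + 1)}. cyc j l) =
      (\<Sum>l\<in>{Suc n..<n + (j + 1)}. cyc j l) + cyc j (n + (j + 1))"
    by simp
  ultimately show ?case using Suc by linarith
qed

text \<open>For \<open>m \<le> j\<close> all lengths \<open>m - i\<close> lie strictly between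
  \<open>0\<close> and \<open>j + 1\<close>, so each of the \<open>m\<close> summands is
  \<open>1\<close>. For \<open>m > j\<close> the surviving lengths \<open>m - j\<close>, ...,
  \<open>m\<close> fill exactly one window.\<close>

lemma cyc_sum_0: "cyc_sum j m 0 = int m * of_bool (m \<le> j)"
proof (cases "m \<le> j")
  case True
  have "cyc j (m - i + 0) * of_bool (i \<le> j) = 1" if "i < m" for i
    using that True by (auto simp: cyc_def dest: dvd_imp_le)
  then show ?thesis using True by (simp add: cyc_sum_def)
next
  case False
  have "cyc_sum j m 0 = (\<Sum>i\<in>{..<j + 1}. cyc j (m - i))"
    unfolding cyc_sum_def using False by (intro sum.mono_neutral_cong_right) auto
  also have "\<dots> = (\<Sum>l\<in>{m - j..<m - j + (j + 1)}. cyc j l)"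
    using False by (intro sum.reindex_bij_witness[of _ "\<lambda>l. m - l" "\<lambda>i. m - i"]) auto
  also have "\<dots> = 0" by (rule sum_cyc_window)
  finally show ?thesis using False by simp
qed

lemma bounded_fact_cyc_sum:
  "m > 0 \<Longrightarrow> bounded_fact j m = fact (m - 1) * cyc_sum j m 0"
  by (cases m) (simp_all add: bounded_fact_def cyc_sum_0 mult.commute)

section \<open>Evaluation of the total weight\<close>

definition colour_class :: "('b \<Rightarrow> 'a) \<Rightarrow> 'b set \<Rightarrow> 'a \<Rightarrow> 'b set" where
  "colour_class x S y = {i \<in> S. x i = y}"

text \<open>Both claims are proved in one induction: the marked recursion needs the total weight of
  the smaller set, and the total weight is the marked total at \<open>t = 0\<close>. The colours
  range over a fixed \<open>Y\<close> because a class may become empty on the way; it then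
  contributes the factor \<open>1\<close>.\<close>

lemma total_weight_cyc_aux:
  fixes x :: "'b \<Rightarrow> 'a"
  assumes "finite Y"
  shows "finite S \<Longrightarrow> card S = n \<Longrightarrow> x ` S \<subseteq> Y \<Longrightarrow>
    total_weight (cyc j) x S = (\<Prod>y\<in>Y. bounded_fact j (card (colour_class x S y))) \<and>
    (\<forall>a\<in>S. \<forall>t. marked_total (cyc j) t a x S =
      (\<Prod>y\<in>Y - {x a}. bounded_fact j (card (colour_class x S y))) *
      fact (card (colour_class x S (x a)) - 1) * cyc_sum j (card (colour_class x S (x a))) t)"
proof (induction n arbitrary: S)
  case 0
  then have "S = {}" by simp
  moreover have "colour_perms x {} = {id}" by (auto simp: colour_perms_def)
  ultimately show ?case
    by (simp add: total_weight_def cycle_weight_def colour_class_def bounded_fact_def)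
next
  case (Suc n)
  let ?g = "\<lambda>S y. bounded_fact j (card (colour_class x S y))"
  have marked: "marked_total (cyc j) t a x S =
      (\<Prod>y\<in>Y - {x a}. ?g S y) *
      fact (card (colour_class x S (x a)) - 1) * cyc_sum j (card (colour_class x S (x a))) t"
    if a: "a \<in> S" for a t
  proof -
    define R where "R = S - {a}"
    define m where "m = card (colour_class x R (x a))"
    define G where "G = (\<Prod>y\<in>Y - {x a}. ?g R y)"
    have R: "finite R" "a \<notin> R" "S = insert a R" "card R = n" "x ` R \<subseteq> Y"
      using Suc.prems a by (auto simp: R_def)
    note IH = Suc.IH[OF R(1,4,5)]
    have "colour_class x S (x a) = insert a (colour_class x R (x a))"
      by (auto simp: R(3) colour_class_def)
    then have m: "card (colour_class x S (x a)) = Suc m"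
      using R(1,2) by (simp add: m_def colour_class_def)
    have "colour_class x S y = colour_class x R y" if "y \<noteq> x a" for y
      using that by (auto simp: R(3) colour_class_def)
    then have G: "(\<Prod>y\<in>Y - {x a}. ?g S y) = G" by (simp add: G_def)
    have "x a \<in> Y" using a Suc.prems(3) by auto
    then have T: "total_weight (cyc j) x R = bounded_fact j m * G"
      using IH assms by (simp add: G_def m_def prod.remove)
    have "(\<Sum>b | b \<in> R \<and> x b = x a. marked_total (cyc j) (Suc t) b x R) =
        (\<Sum>b\<in>colour_class x R (x a). G * fact (m - 1) * cyc_sum j m (Suc t))"
      using IH by (intro sum.cong) (auto simp: colour_class_def G_def m_def)
    also have "\<dots> = int m * (G * fact (m - 1) * cyc_sum j m (Suc t))" by (simp add: m_def)
    \<comment> \<open>For \<open>m = 0\<close> the factors \<open>m * fact (m - 1)\<close> and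
      \<open>fact m\<close> differ, but \<open>cyc_sum j 0\<close> is an empty sum and both sides
      vanish.\<close>
    also have "\<dots> = G * fact m * cyc_sum j m (Suc t)"
      by (cases m) (simp_all add: cyc_sum_def)
    finally have "marked_total (cyc j) t a x S =
        cyc j (Suc t) * (bounded_fact j m * G) + G * fact m * cyc_sum j m (Suc t)"
      using R(1,2) by (simp add: R(3) marked_total_insert T)
    \<comment> \<open>\<open>bounded_fact j m\<close> is \<open>fact m\<close> times the indicator
      of \<open>m \<le> j\<close>, so \<open>G * fact m\<close> factors out and
      \<open>cyc_sum_Suc\<close> remains.\<close>
    also have "\<dots> = G * fact m * cyc_sum j (Suc m) t"
      by (simp add: cyc_sum_Suc bounded_fact_def algebra_simps)
    finally show ?thesis by (simp add: m G)
  qed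
  obtain a where a: "a \<in> S" using Suc.prems(2) by fastforce
  then have pos: "card (colour_class x S (x a)) > 0" and Ya: "x a \<in> Y"
    using Suc.prems by (auto simp: card_gt_0_iff colour_class_def)
  have "total_weight (cyc j) x S = (\<Prod>y\<in>Y - {x a}. ?g S y) * ?g S (x a)"
    using marked[OF a, of 0] bounded_fact_cyc_sum[OF pos, of j]
      total_weight_eq_marked_total[OF Suc.prems(1) a, of "cyc j" x] by simp
  also have "\<dots> = (\<Prod>y\<in>Y. ?g S y)"
    using assms Ya by (simp add: prod.remove mult.commute)
  finally show ?case using marked by blast
qed

lemma total_weight_cyc:
  assumes "finite S"
  shows "total_weight (cyc j) x S = (\<Prod>y\<in>x ` S. bounded_fact j (card (colour_class x S y)))"
  using total_weight_cyc_aux[OF finite_imageI[OF assms] assms refl subset_refl] by (rule conjunct1)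

section \<open>From colourings of positions to tuples and multisets\<close>

lemma weight_eq_cycle_weight: "weight k j \<tau> = cycle_weight (cyc j) {..<k} \<tau>"
  by (simp add: weight_def cycle_weight_def cyc_def cycle_sets_def)

text \<open>Constancy along cycles amounts to invariance under one step of \<open>\<tau>\<close>.
  Indices from \<open>k\<close> on are fixed by \<open>\<tau>\<close>, so the value of
  \<open>xs ! i\<close> there is irrelevant.\<close>

lemma constant_on_cycles_eq:
  assumes "\<tau> permutes {..<k}"
  shows "constant_on_cycles k X \<tau> = {xs \<in> X. \<tau> \<in> colour_perms ((!) xs) {..<k}}"
proof -
  have "(\<forall>C\<in>cycle_sets k \<tau>. \<forall>i\<in>C. \<forall>i'\<in>C. xs ! i = xs ! i') \<longleftrightarrow> (\<forall>i. xs ! \<tau> i = xs ! i)"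
    for xs :: "'a list"
  proof
    assume l: "\<forall>C\<in>cycle_sets k \<tau>. \<forall>i\<in>C. \<forall>i'\<in>C. xs ! i = xs ! i'"
    show "\<forall>i. xs ! \<tau> i = xs ! i"
    proof
      fix i show "xs ! \<tau> i = xs ! i"
      proof (cases "i < k")
        case True
        have "i \<in> orbit \<tau> i" using assms by (intro self_in_orbit_permutes) auto
        moreover have "orbit \<tau> i \<in> cycle_sets k \<tau>" using True by (simp add: cycle_sets_def)
        ultimately show ?thesis using l orbit.base[of \<tau> i] by blast
      qed (use assms permutes_not_in in fastforce)
    qed
  next
    assume r: "\<forall>i. xs ! \<tau> i = xs ! i"
    have "xs ! i = xs ! l" if "i \<in> orbit \<tau> l" for i l
      using that by induction (use r in auto)
    then show "\<forall>C\<in>cycle_sets k \<tau>. \<forall>i\<in>C. \<forall>i'\<in>C. xs ! i = xs ! i'"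
      unfolding cycle_sets_def by (metis imageE)
  qed
  then show ?thesis using assms by (simp add: constant_on_cycles_def colour_perms_def)
qed

lemma card_colour_class_nth: "card (colour_class ((!) xs) {..<length xs} y) = count (mset xs) y"
proof -
  have "colour_class ((!) xs) {..<length xs} y = {i. i < length xs \<and> y = xs ! i}"
    by (auto simp: colour_class_def)
  then show ?thesis by (simp add: count_mset count_list_eq_length_filter length_filter_conv_card)
qed

lemma total_weight_nth:
  "total_weight (cyc j) ((!) xs) {..<length xs} =
     (\<Prod>y\<in>set_mset (mset xs). bounded_fact j (count (mset xs) y))"
proof -
  have "(!) xs ` {..<length xs} = set_mset (mset xs)"
    by (auto simp: set_conv_nth)
  then show ?thesis by (simp add: total_weight_cyc card_colour_class_nth)
qed

text \<open>Two orderings of \<open>M\<close> differ by a permutation of positions, so a symmetric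
  \<open>X\<close> containing one of them contains all.\<close>

lemma orderings_eq_permutations_of_multiset:
  assumes "X \<subseteq> nlists k D" "symmetric_set k X" "M \<in> multisets X"
  shows "{xs \<in> X. mset xs = M} = permutations_of_multiset M"
proof -
  obtain xs where xs: "xs \<in> X" "M = mset xs" using assms(3) by (auto simp: multisets_def)
  then have len: "length xs = k" using assms(1) nlistsE_length by blast
  have "ys \<in> X" if ys: "mset ys = M" for ys
  proof -
    obtain \<tau> where "\<tau> permutes {..<length xs}" "permute_list \<tau> xs = ys"
      using ys xs mset_eq_permutation[of ys xs] by blast
    then show ?thesis using assms(2) xs(1) len unfolding symmetric_set_def by metis
  qed
  then show ?thesis by (auto simp: permutations_of_multiset_def)
qed

lemma size_mem_multisets:
  assumes "X \<subseteq> nlists k D" "M \<in> multisets X"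
  shows "size M = k"
proof -
  obtain xs where xs: "xs \<in> X" "M = mset xs" using assms(2) unfolding multisets_def by blast
  then have "length xs = k" using assms(1) nlistsE_length by blast
  then show ?thesis using xs(2) by simp
qed

lemma prod_bounded_fact:
  "(\<Prod>y\<in>set_mset M. bounded_fact j (count M y)) =
     of_bool (\<forall>y. count M y \<le> j) * (\<Prod>y\<in>set_mset M. fact (count M y))"
proof (cases "\<forall>y. count M y \<le> j")
  case True
  then show ?thesis by (simp add: bounded_fact_def)
next
  case False
  then obtain y where y: "count M y > j" by (auto simp: not_le)
  \<comment> \<open>A multiplicity above \<open>j\<close> is positive, so its zero factor does occur
    in the product over the support.\<close>
  then have "y \<in> set_mset M" by (simp add: count_greater_zero_iff[symmetric] del: count_greater_zero_iff)
  then have "(\<Prod>y\<in>set_mset M. bounded_fact j (count M y)) = 0"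
    using y by (auto simp: bounded_fact_def intro!: bexI[of _ y])
  then show ?thesis unfolding of_bool_def if_not_P[OF False] by (simp only: mult_zero_left)
qed

lemma sum_multisets_le:
  fixes f :: "'a list \<Rightarrow> complex"
  assumes X: "X \<subseteq> nlists k D" "finite X" "symmetric_set k X" "symmetric_fun k X f"
  shows "(\<Sum>M\<in>multisets_le j X. on_mset X f M) =
           1 / fact k *
             (\<Sum>\<tau> | \<tau> permutes {..<k}.
                of_int (weight k j \<tau>) * (\<Sum>xs\<in>constant_on_cycles k X \<tau>. f xs))"
proof -
  let ?P = "{\<tau>. \<tau> permutes {..<k}}"
  let ?S = "\<lambda>xs. colour_perms ((!) xs) {..<k}"
  let ?B = "\<lambda>M. \<Prod>y\<in>set_mset M. bounded_fact j (count M y)"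
  have finP: "finite ?P" by (simp add: finite_permutations)
  have finM: "finite (multisets X)" using X(2) by (simp add: multisets_def)
  have "(\<Sum>\<tau>\<in>?P. of_int (weight k j \<tau>) * (\<Sum>xs\<in>constant_on_cycles k X \<tau>. f xs)) =
      (\<Sum>\<tau>\<in>?P. \<Sum>xs | xs \<in> X \<and> \<tau> \<in> ?S xs. of_int (weight k j \<tau>) * f xs)"
    by (intro sum.cong refl) (simp add: constant_on_cycles_eq sum_distrib_left)
  also have "\<dots> = (\<Sum>xs\<in>X. \<Sum>\<tau> | \<tau> \<in> ?P \<and> \<tau> \<in> ?S xs. of_int (weight k j \<tau>) * f xs)"
    by (rule sum.swap_restrict[OF finP X(2)])
  also have "\<dots> = (\<Sum>xs\<in>X. of_int (total_weight (cyc j) ((!) xs) {..<k}) * f xs)"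
  proof (intro sum.cong refl)
    fix xs :: "'a list"
    have "{\<tau>. \<tau> \<in> ?P \<and> \<tau> \<in> ?S xs} = ?S xs" by (auto simp: colour_perms_def)
    then show "(\<Sum>\<tau> | \<tau> \<in> ?P \<and> \<tau> \<in> ?S xs. of_int (weight k j \<tau>) * f xs) =
        of_int (total_weight (cyc j) ((!) xs) {..<k}) * f xs"
      by (simp add: total_weight_def weight_eq_cycle_weight sum_distrib_right)
  qed
  also have "\<dots> = (\<Sum>xs\<in>X. of_int (?B (mset xs)) * on_mset X f (mset xs))"
  proof (intro sum.cong refl)
    fix xs assume xs: "xs \<in> X"
    then have "length xs = k" using X(1) nlistsE_length by blast
    then show "of_int (total_weight (cyc j) ((!) xs) {..<k}) * f xs =
        of_int (?B (mset xs)) * on_mset X f (mset xs)"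
      using total_weight_nth[of j xs] on_mset_eq[OF X(1,4) xs] by simp
  qed
  \<comment> \<open>The summand now depends only on \<open>mset xs\<close>, hence is constant on
    each fibre of \<open>mset\<close>.\<close>
  also have "\<dots> = (\<Sum>M\<in>multisets X. \<Sum>xs | xs \<in> X \<and> mset xs = M.
      of_int (?B (mset xs)) * on_mset X f (mset xs))"
    using X(2) finM by (intro sum.group[symmetric]) (auto simp: multisets_def)
  also have "\<dots> = (\<Sum>M\<in>multisets X. fact k * (of_bool (\<forall>y. count M y \<le> j) * on_mset X f M))"
  proof (intro sum.cong refl)
    fix M assume M: "M \<in> multisets X"
    have "(\<Sum>xs | xs \<in> X \<and> mset xs = M. of_int (?B (mset xs)) * on_mset X f (mset xs)) =
        of_nat (card (permutations_of_multiset M)) * (of_int (?B M) * on_mset X f M)"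
      by (simp add: orderings_eq_permutations_of_multiset[OF X(1,3) M, symmetric])
    also have "of_int (?B M) = (of_bool (\<forall>y. count M y \<le> j) *
        of_nat (\<Prod>y\<in>set_mset M. fact (count M y)) :: complex)"
      by (simp add: prod_bounded_fact)
    also have "of_nat (card (permutations_of_multiset M)) *
        (of_bool (\<forall>y. count M y \<le> j) * of_nat (\<Prod>y\<in>set_mset M. fact (count M y)) * on_mset X f M) =
        of_nat (card (permutations_of_multiset M) * (\<Prod>y\<in>set_mset M. fact (count M y))) *
        (of_bool (\<forall>y. count M y \<le> j) * on_mset X f M)"
      by (simp only: of_nat_mult mult_ac)
    \<comment> \<open>The number of orderings times the product of the factorials of the
      multiplicities is the factorial of the size of \<open>M\<close>.\<close>
    also have "\<dots> = fact k * (of_bool (\<forall>y. count M y \<le> j) * on_mset X f M)"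
      by (simp only: card_permutations_of_multiset_aux size_mem_multisets[OF X(1) M] of_nat_fact)
    finally show "(\<Sum>xs | xs \<in> X \<and> mset xs = M. of_int (?B (mset xs)) * on_mset X f (mset xs)) =
        fact k * (of_bool (\<forall>y. count M y \<le> j) * on_mset X f M)" .
  qed
  also have "\<dots> = fact k * (\<Sum>M\<in>multisets X. of_bool (\<forall>y. count M y \<le> j) * on_mset X f M)"
    by (simp add: sum_distrib_left)
  also have "(\<Sum>M\<in>multisets X. of_bool (\<forall>y. count M y \<le> j) * on_mset X f M) =
      (\<Sum>M\<in>multisets_le j X. on_mset X f M)"
    using finM by (intro sum.mono_neutral_cong_right) (auto simp: multisets_le_def)
  finally show ?thesis by simp
qed

section \<open>Large \<open>j\<close>, and the theorem\<close>

lemma weight_eq_1: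
  assumes "\<tau> permutes {..<k}" "k \<le> j"
  shows "weight k j \<tau> = 1"
  unfolding weight_def
proof (intro prod.neutral ballI)
  fix C assume "C \<in> cycle_sets k \<tau>"
  then obtain i where i: "i < k" "C = orbit \<tau> i" by (auto simp: cycle_sets_def)
  then have C: "C \<subseteq> {..<k}" "i \<in> C"
    using permutes_orbit_subset[OF assms(1), of i] self_in_orbit_permutes[OF _ assms(1)] by auto
  then have "card C \<le> k" "card C > 0"
    using card_mono[OF _ C(1)] finite_subset[OF C(1)] by (auto simp: card_gt_0_iff)
  \<comment> \<open>A cycle length is positive and at most \<open>k\<close>, hence below
    \<open>j + 1\<close>.\<close>
  then have "\<not> (j + 1) dvd card C" using assms(2) by (auto dest: dvd_imp_le)
  then show "1 - (int j + 1) * of_bool ((j + 1) dvd card C) = 1" by simp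
qed

lemma multisets_le_eq_multisets:
  assumes "X \<subseteq> nlists k D" "k \<le> j"
  shows "multisets_le j X = multisets X"
proof -
  have "count M y \<le> j" if "M \<in> multisets X" for M y
    using count_le_size[of M y] size_mem_multisets[OF assms(1) that] assms(2) by linarith
  then show ?thesis unfolding multisets_le_def by blast
qed

theorem theorem1p9:
  fixes D :: "'a set" and k j :: nat and X :: "'a list set" and f :: "'a list \<Rightarrow> complex"
  assumes "k > 0" and "j > 0"
    and "X \<subseteq> nlists k D" and "finite X" and "symmetric_set k X"
    and "symmetric_fun k X f"
  shows "(\<Sum>M\<in>multisets_le j X. on_mset X f M) =
           1 / fact k *
             (\<Sum>\<tau> | \<tau> permutes {..<k}.
                of_int (weight k j \<tau>) * (\<Sum>xs\<in>constant_on_cycles k X \<tau>. f xs))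
       \<and> (j \<ge> k \<longrightarrow>
           (\<Sum>M\<in>multisets X. on_mset X f M) =
             1 / fact k *
               (\<Sum>\<tau> | \<tau> permutes {..<k}. \<Sum>xs\<in>constant_on_cycles k X \<tau>. f xs))"
proof (intro conjI impI)
  note eq = sum_multisets_le[OF assms(3-6), of j]
  then show "(\<Sum>M\<in>multisets_le j X. on_mset X f M) =
           1 / fact k *
             (\<Sum>\<tau> | \<tau> permutes {..<k}.
                of_int (weight k j \<tau>) * (\<Sum>xs\<in>constant_on_cycles k X \<tau>. f xs))" .
  assume "j \<ge> k"
  then show "(\<Sum>M\<in>multisets X. on_mset X f M) =
             1 / fact k *
               (\<Sum>\<tau> | \<tau> permutes {..<k}. \<Sum>xs\<in>constant_on_cycles k X \<tau>. f xs)"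
    using eq by (simp add: multisets_le_eq_multisets[OF assms(3)] weight_eq_1)
qed

end
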